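(* Let $\epsilon>0$, $\rho>0$, and consider the objective $F_T(w)=N_{\mathrm{eff}}(w)\,\bigl(\epsilon-D_1(w)\rho\bigr)_+^{2}$ for $w\in\mathcal{W}_T$. (i) Let $T\in\mathbb{N}$. For $s\in\{1,\ldots,T\}$ let $w^{(s)}\in\mathcal{W}_T$ be the window weights of size $s$. Then an optimal window size, i.e. a maximizer of $s\mapsto F_T(w^{(s)})$ over $s\in\{1,\ldots,T\}$, is given by either \[ s=\Bigl\lfloor\tfrac13\bigl(2\epsilon/\rho-1\bigr)\Bigr\rfloor_{[1,T]}\quad\text{or}\quad s=\Bigl\lceil\tfrac13\bigl(2\epsilon/\rho-1\bigr)\Bigr\rceil_{[1,T]}. \] (ii) For $\alpha\in[0,1]$ let $w^{(\alpha,T)}\in\mathcal{W}_T$ be the smoothing weights with decay rate $\alpha$. As $T\to\infty$, the optimal decay rate is \[ \alpha=\Bigl(\frac{3}{\epsilon/\rho+1}\Bigr)_{[(\rho/\epsilon)_{[0,1]},\,1]}, \] that is, this $\alpha$ maximizes the limiting objective $\alpha\mapsto\lim_{T\to\infty}F_T(w^{(\alpha,T)})$ over $\alpha\in[0,1]$.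
   Context: $x_+=\max\{0,x\}$. For $x\in\mathbb{R}$ and an interval $[a,b]$, $x_{[a,b]}=\min\{\max\{x,a\},b\}$ is the projection of $x$ onto $[a,b]$ (so $\lfloor y\rfloor_{[1,T]}$ is the projection of $\lfloor y\rfloor$ onto $[1,T]$, and similarly for $\lceil y\rceil$). $\mathcal{W}_T=\{w\in\mathbb{R}^T: w_t\ge 0,\ \sum_{t=1}^T w_t=1\}$. $N_{\mathrm{eff}}(w)=1/\sum_{t=1}^T w_t^2$ and $D_1(w)=\sum_{t=1}^T w_t(T-t+1)$. Window weights of size $s$: $w_t=1/s$ for $T-s+1\le t\le T$ and $w_t=0$ for $t\le T-s$. Smoothing weights with decay rate $\alpha$: for $\alpha\in(0,1]$, $w_t$ is proportional to $\alpha(1-\alpha)^{T-t}$, $t\in\{1,\ldots,T\}$ (with $0^0=1$), scaled to sum to $1$; for $\alpha=0$, $w_t=1/T$ for all $t$. *)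

theory Defs
  imports Complex_Main
begin

definition pos_part :: "real \<Rightarrow> real" where
  "pos_part x = max 0 x"

definition proj_Icc :: "'a::linorder \<Rightarrow> 'a \<Rightarrow> 'a \<Rightarrow> 'a" where
  "proj_Icc a b x = min (max x a) b"

text \<open>A vector in \<open>T\<close>-dimensional real space is a function on \<open>nat\<close> with coordinates
  \<open>1, \<dots>, T\<close>, vanishing at all other indices.\<close>

definition weights :: "nat \<Rightarrow> (nat \<Rightarrow> real) set" where
  "weights T = {w. (\<forall>t. t \<notin> {1..T} \<longrightarrow> w t = 0) \<and> (\<forall>t\<in>{1..T}. w t \<ge> 0) \<and> (\<Sum>t=1..T. w t) = 1}"

definition N_eff :: "nat \<Rightarrow> (nat \<Rightarrow> real) \<Rightarrow> real" where
  "N_eff T w = 1 / (\<Sum>t=1..T. (w t)\<^sup>2)"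

definition D1 :: "nat \<Rightarrow> (nat \<Rightarrow> real) \<Rightarrow> real" where
  "D1 T w = (\<Sum>t=1..T. w t * (real T - real t + 1))"

definition objective :: "real \<Rightarrow> real \<Rightarrow> nat \<Rightarrow> (nat \<Rightarrow> real) \<Rightarrow> real" where
  "objective \<epsilon> \<rho> T w = N_eff T w * (pos_part (\<epsilon> - D1 T w * \<rho>))\<^sup>2"

definition window_weights :: "nat \<Rightarrow> nat \<Rightarrow> nat \<Rightarrow> real" where
  "window_weights T s t = (if T - s + 1 \<le> t \<and> t \<le> T then 1 / real s else 0)"

definition smoothing_weights :: "nat \<Rightarrow> real \<Rightarrow> nat \<Rightarrow> real" where
  "smoothing_weights T \<alpha> t =
     (if t \<in> {1..T} then
        (if \<alpha> = 0 then 1 / real T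
         else \<alpha> * (1 - \<alpha>) ^ (T - t) / (\<Sum>u=1..T. \<alpha> * (1 - \<alpha>) ^ (T - u)))
      else 0)"

end

(*
  Everything is a function of the lag k = T - t. Up to the factor rho^2/4, both objectives are
  the single profile s * (a - s)_+^2 with a = 2 epsilon/rho - 1: the window of size s has
  N_eff = s and D_1 = (s + 1)/2, and in the limit the decay rate alpha has N_eff = s and
  D_1 = (s + 1)/2 for the real "effective window size" s = 2/alpha - 1, ranging over s >= 1.
  The profile increases up to s = a/3 and decreases afterwards. Hence the best integer is a
  neighbour of a/3, and the best alpha solves 2/alpha - 1 = max 1 (a/3).
*)
theory Submission
  imports Defs
begin

section \<open>The one-variable profile: its monotonicity and its link to the objective\<close>

definition profile :: "real \<Rightarrow> real \<Rightarrow> real" where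
  "profile a s = s * (pos_part (a - s))\<^sup>2"

lemma profile_nonneg: "0 \<le> s \<Longrightarrow> 0 \<le> profile a s"
  by (simp add: profile_def)

text \<open>Here \<open>s \<le> t \<le> a\<close>, so no positive part is truncated and the
  difference of the two values is a polynomial divisible by \<open>t - s\<close>. Expanding the
  cofactor in the slack \<open>d = a - 3 * t\<close> leaves only nonnegative terms.\<close>

lemma profile_mono:
  assumes "0 \<le> s" "s \<le> t" "3 * t \<le> a"
  shows "profile a s \<le> profile a t"
proof -
  define d where "d = a - 3 * t"
  have "0 \<le> d\<^sup>2 + d * (4 * t - 2 * s) + (4 * t - s) * (t - s)"
    using assms by (intro add_nonneg_nonneg mult_nonneg_nonneg) (auto simp: d_def)
  with assms have "0 \<le> (t - s) * (d\<^sup>2 + d * (4 * t - 2 * s) + (4 * t - s) * (t - s))"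
    by simp
  also have "\<dots> = t * (a - t)\<^sup>2 - s * (a - s)\<^sup>2"
    unfolding d_def by algebra
  finally show ?thesis
    using assms by (simp add: profile_def pos_part_def max_def)
qed

text \<open>From \<open>a\<close> onwards the profile is zero. Below \<open>a\<close>, the cofactor
  of \<open>t - s\<close> is nonnegative because
  \<open>t + 2 * s - a \<ge> 3 * s - a \<ge> 0\<close>.\<close>

lemma profile_antimono:
  assumes "0 \<le> s" "s \<le> t" "a \<le> 3 * s"
  shows "profile a t \<le> profile a s"
proof (cases "t < a")
  case True
  have "0 \<le> (a - t) * (t + 2 * s - a) + s * (t - s)"
    using assms True by (intro add_nonneg_nonneg mult_nonneg_nonneg) auto
  with assms have "0 \<le> (t - s) * ((a - t) * (t + 2 * s - a) + s * (t - s))"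
    by simp
  also have "\<dots> = s * (a - s)\<^sup>2 - t * (a - t)\<^sup>2"
    by algebra
  finally show ?thesis
    using assms True by (simp add: profile_def pos_part_def max_def)
next
  case False
  then have "profile a t = 0"
    by (simp add: profile_def pos_part_def max_def)
  with profile_nonneg assms show ?thesis by metis
qed

text \<open>The left side is the objective of any weights with \<open>N_eff\<close> equal to
  \<open>s\<close> and \<open>D1\<close> equal to \<open>(s + 1) / 2\<close>. As
  \<open>\<rho> > 0\<close>, the factor \<open>\<rho> / 2\<close> can be pulled out of the positive
  part.\<close>

lemma profile_rescale:
  fixes \<epsilon> \<rho> s :: real
  assumes "\<rho> > 0"
  shows "s * (pos_part (\<epsilon> - (s + 1) / 2 * \<rho>))\<^sup>2 = \<rho>\<^sup>2 / 4 * profile (2 * \<epsilon> / \<rho> - 1) s"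
proof -
  have "pos_part (\<epsilon> - (s + 1) / 2 * \<rho>) = \<rho> / 2 * pos_part (2 * \<epsilon> / \<rho> - 1 - s)"
    using assms by (auto simp: pos_part_def max_def field_simps)
  then show ?thesis
    unfolding profile_def by (simp only: power_mult_distrib power_divide) simp
qed

section \<open>Reindexing by lag\<close>

lemma sum_lags:
  fixes f :: "nat \<Rightarrow> 'a::comm_monoid_add"
  shows "(\<Sum>t=1..T. f (T - t)) = (\<Sum>k<T. f k)"
  by (rule sum.reindex_bij_witness[of _ "\<lambda>k. T - k" "\<lambda>t. T - t"]) auto

lemma
  assumes "\<And>t. t \<in> {1..T} \<Longrightarrow> w t = v (T - t)"
  shows sum_eq_lags: "(\<Sum>t=1..T. w t) = (\<Sum>k<T. v k)"
    and N_eff_eq_lags: "N_eff T w = 1 / (\<Sum>k<T. (v k)\<^sup>2)"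
    and D1_eq_lags: "D1 T w = (\<Sum>k<T. v k * (real k + 1))"
proof -
  show "(\<Sum>t=1..T. w t) = (\<Sum>k<T. v k)"
    using assms by (simp flip: sum_lags)
  show "N_eff T w = 1 / (\<Sum>k<T. (v k)\<^sup>2)"
    using assms by (simp add: N_eff_def flip: sum_lags)
  show "D1 T w = (\<Sum>k<T. v k * (real k + 1))"
    using assms by (simp add: D1_def of_nat_diff flip: sum_lags)
qed

subsection \<open>Window weights\<close>

lemma window_weights_lag:
  assumes "s \<le> T" "t \<in> {1..T}"
  shows "window_weights T s t = (if T - t < s then 1 / real s else 0)"
  using assms by (auto simp: window_weights_def)

lemma sum_lessThan_cutoff:
  fixes f :: "nat \<Rightarrow> 'a::comm_monoid_add"
  assumes "s \<le> T"
  shows "(\<Sum>k<T. if k < s then f k else 0) = (\<Sum>k<s. f k)"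
proof -
  have "{k \<in> {..<T}. k < s} = {..<s}"
    using assms by auto
  then show ?thesis
    by (simp flip: sum.inter_filter)
qed

lemma window_weights_in_weights:
  assumes "s \<in> {1..T}"
  shows "window_weights T s \<in> weights T"
proof -
  have "(\<Sum>t=1..T. window_weights T s t) = (\<Sum>k<T. if k < s then 1 / real s else 0)"
    using assms by (intro sum_eq_lags window_weights_lag) auto
  also have "\<dots> = 1"
    using assms by (subst sum_lessThan_cutoff) auto
  finally show ?thesis
    using assms by (auto simp: weights_def window_weights_def)
qed

lemma N_eff_window_weights:
  assumes "s \<in> {1..T}"
  shows "N_eff T (window_weights T s) = real s"
proof -
  have "N_eff T (window_weights T s) = 1 / (\<Sum>k<T. (if k < s then 1 / real s else 0)\<^sup>2)"
    using assms by (intro N_eff_eq_lags window_weights_lag) auto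
  also have "(\<Sum>k<T. (if k < s then 1 / real s else 0)\<^sup>2) = (\<Sum>k<T. if k < s then (1 / real s)\<^sup>2 else 0)"
    by (intro sum.cong) auto
  also have "\<dots> = 1 / real s"
    using assms by (subst sum_lessThan_cutoff) (auto simp: power2_eq_square)
  finally show ?thesis by simp
qed

lemma sum_Suc_lags: "(\<Sum>k<n. real k + 1) = real n * (real n + 1) / 2"
  by (induction n) (auto simp: field_simps)

lemma D1_window_weights:
  assumes "s \<in> {1..T}"
  shows "D1 T (window_weights T s) = (real s + 1) / 2"
proof -
  have "D1 T (window_weights T s) = (\<Sum>k<T. (if k < s then 1 / real s else 0) * (real k + 1))"
    using assms by (intro D1_eq_lags window_weights_lag) auto
  also have "\<dots> = (\<Sum>k<T. if k < s then (real k + 1) / real s else 0)"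
    by (intro sum.cong) auto
  also have "\<dots> = (\<Sum>k<s. real k + 1) / real s"
    using assms by (subst sum_lessThan_cutoff) (auto simp: sum_divide_distrib)
  also have "\<dots> = (real s + 1) / 2"
    using assms by (simp add: sum_Suc_lags)
  finally show ?thesis .
qed

text \<open>With \<open>a = 3 * x\<close> the peak sits at \<open>x\<close>. Since \<open>s\<close>
  itself lies in the range, projecting keeps the candidate between \<open>s\<close> and
  \<open>x\<close>: either \<open>s \<le> p \<le> x\<close> or \<open>x \<le> q \<le> s\<close>, and
  monotonicity on that side of the peak decides.\<close>

lemma profile_le_floor_or_ceiling:
  fixes s T :: nat and x :: real
  assumes "s \<in> {1..T}"
  defines "p \<equiv> nat (proj_Icc 1 (int T) \<lfloor>x\<rfloor>)" and "q \<equiv> nat (proj_Icc 1 (int T) \<lceil>x\<rceil>)"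
  shows "profile (3 * x) (real s) \<le> profile (3 * x) (real p) \<or>
         profile (3 * x) (real s) \<le> profile (3 * x) (real q)"
proof (cases "real s \<le> x")
  case True
  then have "int s \<le> \<lfloor>x\<rfloor>" by (simp add: le_floor_iff)
  with assms(1) have "s \<le> p" "int p \<le> \<lfloor>x\<rfloor>"
    by (auto simp: p_def proj_Icc_def)
  then have "real s \<le> real p" "real p \<le> x"
    by (simp_all add: le_floor_iff)
  then show ?thesis
    using profile_mono[of "real s" "real p" "3 * x"] by simp
next
  case False
  then have "\<lceil>x\<rceil> \<le> int s" by (simp add: ceiling_le_iff)
  with assms(1) have "q \<le> s" "\<lceil>x\<rceil> \<le> int q"
    by (auto simp: q_def proj_Icc_def)
  then have "real q \<le> real s" "x \<le> real q"
    by (simp_all add: ceiling_le_iff)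
  then show ?thesis
    using profile_antimono[of "real q" "real s" "3 * x"] by simp
qed

text \<open>Which candidate wins may depend on \<open>s\<close>; the better of \<open>p\<close> and
  \<open>q\<close> then dominates every \<open>s\<close>.\<close>

lemma is_arg_max_two_candidates:
  fixes f :: "'a \<Rightarrow> 'b::linorder"
  assumes "P p" "P q" "\<And>s. P s \<Longrightarrow> f s \<le> f p \<or> f s \<le> f q"
  shows "is_arg_max f P p \<or> is_arg_max f P q"
  using assms by (cases "f p \<le> f q") (fastforce simp: is_arg_max_linorder)+

lemma optimal_window_size:
  fixes \<epsilon> \<rho> :: real
  assumes "\<rho> > 0" "T \<ge> 1"
  defines "x \<equiv> 1 / 3 * (2 * \<epsilon> / \<rho> - 1)"
  shows "is_arg_max (\<lambda>s. objective \<epsilon> \<rho> T (window_weights T s)) (\<lambda>s. s \<in> {1..T})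
           (nat (proj_Icc 1 (int T) \<lfloor>x\<rfloor>)) \<or>
         is_arg_max (\<lambda>s. objective \<epsilon> \<rho> T (window_weights T s)) (\<lambda>s. s \<in> {1..T})
           (nat (proj_Icc 1 (int T) \<lceil>x\<rceil>))"
proof (rule is_arg_max_two_candidates)
  have dom: "nat (proj_Icc 1 (int T) y) \<in> {1..T}" for y
    using assms(2) by (auto simp: proj_Icc_def)
  show "nat (proj_Icc 1 (int T) \<lfloor>x\<rfloor>) \<in> {1..T}" "nat (proj_Icc 1 (int T) \<lceil>x\<rceil>) \<in> {1..T}"
    by (rule dom)+
  have obj: "objective \<epsilon> \<rho> T (window_weights T s) = \<rho>\<^sup>2 / 4 * profile (3 * x) (real s)"
    if "s \<in> {1..T}" for s
  proof -
    have "3 * x = 2 * \<epsilon> / \<rho> - 1"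
      by (simp add: x_def)
    then show ?thesis
      using profile_rescale[OF assms(1), of "real s"] that
      by (simp only: objective_def N_eff_window_weights D1_window_weights)
  qed
  fix s assume s: "s \<in> {1..T}"
  show "objective \<epsilon> \<rho> T (window_weights T s)
          \<le> objective \<epsilon> \<rho> T (window_weights T (nat (proj_Icc 1 (int T) \<lfloor>x\<rfloor>))) \<or>
        objective \<epsilon> \<rho> T (window_weights T s)
          \<le> objective \<epsilon> \<rho> T (window_weights T (nat (proj_Icc 1 (int T) \<lceil>x\<rceil>)))"
    using profile_le_floor_or_ceiling[OF s, of x] assms(1)
    unfolding obj[OF s] obj[OF dom] by (auto intro!: mult_left_mono)
qed

subsection \<open>Smoothing weights\<close>

lemma smoothing_weights_in_weights:
  assumes "T \<ge> 1" "\<alpha> \<in> {0..1}"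
  shows "smoothing_weights T \<alpha> \<in> weights T"
proof (cases "\<alpha> = 0")
  case True
  then show ?thesis
    using assms by (auto simp: weights_def smoothing_weights_def)
next
  case False
  let ?S = "\<Sum>u=1..T. \<alpha> * (1 - \<alpha>) ^ (T - u)"
  \<comment> \<open>The summand at \<open>u = T\<close> equals \<open>\<alpha>\<close>, also for
    \<open>\<alpha> = 1\<close>, where \<open>0 ^ 0 = 1\<close> and all other summands
    vanish.\<close>
  have "0 < \<alpha> * (1 - \<alpha>) ^ (T - T)" using False assms by simp
  also have "\<dots> \<le> ?S"
    using assms by (intro member_le_sum) auto
  finally have "?S > 0" .
  moreover have "(\<Sum>t=1..T. smoothing_weights T \<alpha> t) = (\<Sum>t=1..T. \<alpha> * (1 - \<alpha>) ^ (T - t) / ?S)"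
    using False by (intro sum.cong) (auto simp: smoothing_weights_def)
  ultimately have "(\<Sum>t=1..T. smoothing_weights T \<alpha> t) = 1"
    by (simp flip: sum_divide_distrib)
  then show ?thesis
    using assms False \<open>?S > 0\<close>
    by (auto simp: weights_def smoothing_weights_def intro!: divide_nonneg_pos)
qed

text \<open>The factor \<open>\<alpha>\<close> cancels in the normalization, leaving a truncated
  geometric distribution over the lags.\<close>

lemma smoothing_weights_lag:
  assumes "\<alpha> \<noteq> 0" "t \<in> {1..T}"
  shows "smoothing_weights T \<alpha> t = (1 - \<alpha>) ^ (T - t) / (\<Sum>k<T. (1 - \<alpha>) ^ k)"
  using assms sum_lags[of "\<lambda>k. (1 - \<alpha>) ^ k" T]
  by (simp add: smoothing_weights_def flip: sum_distrib_left)

lemma LIMSEQ_geometric_sum: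
  assumes "0 < \<alpha>" "\<alpha> \<le> (1::real)"
  shows "(\<lambda>T. \<Sum>k<T. (1 - \<alpha>) ^ k) \<longlonglongrightarrow> 1 / \<alpha>"
  using geometric_sums[of "1 - \<alpha>"] assms by (simp add: sums_def)

text \<open>With \<open>q = 1 - \<alpha>\<close>, \<open>N_eff\<close> is the squared geometric sum
  in \<open>q\<close> over the geometric sum in \<open>q\<^sup>2\<close>, where
  \<open>1 - q\<^sup>2 = \<alpha> * (2 - \<alpha>)\<close>.\<close>

lemma LIMSEQ_N_eff_smoothing:
  assumes "0 < \<alpha>" "\<alpha> \<le> 1"
  shows "(\<lambda>T. N_eff T (smoothing_weights T \<alpha>)) \<longlonglongrightarrow> 2 / \<alpha> - 1"
proof -
  define q where "q = 1 - \<alpha>"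
  have q: "0 \<le> q" "q < 1" using assms by (auto simp: q_def)
  then have "q\<^sup>2 < 1" by (simp add: power_less_one_iff)
  then have "(\<lambda>T. \<Sum>k<T. (q\<^sup>2) ^ k) \<longlonglongrightarrow> 1 / (1 - q\<^sup>2)"
    using geometric_sums[of "q\<^sup>2"] by (simp add: sums_def)
  moreover have "1 - q\<^sup>2 = \<alpha> * (2 - \<alpha>)"
    by (simp add: q_def power2_eq_square algebra_simps)
  ultimately have "(\<lambda>T. (\<Sum>k<T. q ^ k)\<^sup>2 / (\<Sum>k<T. (q\<^sup>2) ^ k)) \<longlonglongrightarrow> (1 / \<alpha>)\<^sup>2 / (1 / (\<alpha> * (2 - \<alpha>)))"
    using assms LIMSEQ_geometric_sum[OF assms]
    by (intro tendsto_divide tendsto_power) (auto simp: q_def)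
  moreover have "(1 / \<alpha>)\<^sup>2 / (1 / (\<alpha> * (2 - \<alpha>))) = 2 / \<alpha> - 1"
    using assms by (simp add: power2_eq_square field_simps)
  moreover have "N_eff T (smoothing_weights T \<alpha>) = (\<Sum>k<T. q ^ k)\<^sup>2 / (\<Sum>k<T. (q\<^sup>2) ^ k)" for T
  proof -
    have "N_eff T (smoothing_weights T \<alpha>) = 1 / (\<Sum>k<T. (q ^ k / (\<Sum>k<T. q ^ k))\<^sup>2)"
      using assms unfolding q_def by (intro N_eff_eq_lags smoothing_weights_lag) auto
    then show ?thesis
      by (simp add: power_divide mult.commute flip: sum_divide_distrib power_mult)
  qed
  ultimately show ?thesis by simp
qed

text \<open>The numerator is the termwise derivative of the geometric series, with sum
  \<open>1 / \<alpha>\<^sup>2\<close>; the normalizer tends to \<open>1 / \<alpha>\<close>.\<close>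

lemma LIMSEQ_D1_smoothing:
  assumes "0 < \<alpha>" "\<alpha> \<le> 1"
  shows "(\<lambda>T. D1 T (smoothing_weights T \<alpha>)) \<longlonglongrightarrow> 1 / \<alpha>"
proof -
  define q where "q = 1 - \<alpha>"
  have "(\<lambda>T. \<Sum>k<T. of_nat (Suc k) * q ^ k) \<longlonglongrightarrow> 1 / \<alpha>\<^sup>2"
    using geometric_deriv_sums[of q] assms by (simp add: sums_def q_def)
  then have "(\<lambda>T. (\<Sum>k<T. of_nat (Suc k) * q ^ k) / (\<Sum>k<T. q ^ k)) \<longlonglongrightarrow> (1 / \<alpha>\<^sup>2) / (1 / \<alpha>)"
    using assms LIMSEQ_geometric_sum[OF assms]
    by (intro tendsto_divide) (auto simp: q_def)
  moreover have "(1 / \<alpha>\<^sup>2) / (1 / \<alpha>) = 1 / \<alpha>"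
    using assms by (simp add: power2_eq_square field_simps)
  moreover have "D1 T (smoothing_weights T \<alpha>) = (\<Sum>k<T. of_nat (Suc k) * q ^ k) / (\<Sum>k<T. q ^ k)" for T
  proof -
    have "D1 T (smoothing_weights T \<alpha>) = (\<Sum>k<T. q ^ k / (\<Sum>k<T. q ^ k) * (real k + 1))"
      using assms unfolding q_def by (intro D1_eq_lags smoothing_weights_lag) auto
    then show ?thesis
      by (simp add: sum_divide_distrib algebra_simps)
  qed
  ultimately show ?thesis by simp
qed

text \<open>Rate 0 is split off because it corresponds to an infinite effective size, whereas
  \<open>2 / 0 = 0\<close> would turn the formula into size -1.\<close>

definition smoothing_limit :: "real \<Rightarrow> real \<Rightarrow> real \<Rightarrow> real" where
  "smoothing_limit \<epsilon> \<rho> \<alpha> =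
     (if \<alpha> = 0 then 0 else \<rho>\<^sup>2 / 4 * profile (2 * \<epsilon> / \<rho> - 1) (2 / \<alpha> - 1))"

lemma LIMSEQ_objective_smoothing:
  assumes "\<rho> > 0" "\<alpha> \<in> {0..1}"
  shows "(\<lambda>T. objective \<epsilon> \<rho> T (smoothing_weights T \<alpha>)) \<longlonglongrightarrow> smoothing_limit \<epsilon> \<rho> \<alpha>"
proof (cases "\<alpha> = 0")
  case True
  \<comment> \<open>Uniform weights have \<open>D1\<close> equal to \<open>(T + 1) / 2\<close>, so
    beyond this bound the positive part is zero.\<close>
  obtain n :: nat where n: "2 * \<epsilon> / \<rho> \<le> real n"
    using real_arch_simple by blast
  have "objective \<epsilon> \<rho> T (smoothing_weights T \<alpha>) = 0" if "T \<ge> Suc n" for T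
  proof -
    have "D1 T (smoothing_weights T \<alpha>) = (\<Sum>k<T. 1 / real T * (real k + 1))"
      using True by (intro D1_eq_lags) (auto simp: smoothing_weights_def)
    also have "\<dots> = (real T + 1) / 2"
      using that by (simp add: sum_Suc_lags flip: sum_divide_distrib)
    finally have D1: "D1 T (smoothing_weights T \<alpha>) = (real T + 1) / 2" .
    have "2 * \<epsilon> / \<rho> \<le> real T + 1"
      using n that by linarith
    then have "\<epsilon> - (real T + 1) / 2 * \<rho> \<le> 0"
      using assms(1) by (simp add: field_simps)
    then show ?thesis
      by (simp add: objective_def D1 pos_part_def)
  qed
  then have "\<forall>\<^sub>F T in sequentially. objective \<epsilon> \<rho> T (smoothing_weights T \<alpha>) = 0"
    by (rule eventually_sequentiallyI)
  then show ?thesis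
    using True by (simp add: smoothing_limit_def tendsto_eventually)
next
  case False
  with assms have \<alpha>: "0 < \<alpha>" "\<alpha> \<le> 1" by auto
  \<comment> \<open>The limit \<open>1 / \<alpha>\<close> is written so that
    \<open>profile_rescale\<close> matches with \<open>s = 2 / \<alpha> - 1\<close>.\<close>
  have "(\<lambda>T. D1 T (smoothing_weights T \<alpha>)) \<longlonglongrightarrow> ((2 / \<alpha> - 1) + 1) / 2"
    using LIMSEQ_D1_smoothing[OF \<alpha>] by simp
  then have "(\<lambda>T. objective \<epsilon> \<rho> T (smoothing_weights T \<alpha>))
          \<longlonglongrightarrow> (2 / \<alpha> - 1) * (pos_part (\<epsilon> - ((2 / \<alpha> - 1) + 1) / 2 * \<rho>))\<^sup>2"
    unfolding objective_def pos_part_def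
    by (intro tendsto_intros LIMSEQ_N_eff_smoothing \<alpha>)
  then show ?thesis
    using False by (simp only: profile_rescale[OF assms(1)] smoothing_limit_def if_False)
qed

text \<open>The lower projection bound \<open>\<rho> / \<epsilon>\<close> never matters: it exceeds \<open>3 / (\<epsilon> / \<rho> + 1)\<close> only when
  \<open>\<epsilon> / \<rho> < 1 / 2\<close>, and then both projections return \<open>1\<close>.\<close>

lemma proj_decay_rate:
  fixes \<epsilon> \<rho> :: real
  assumes "\<epsilon> > 0" "\<rho> > 0"
  shows "proj_Icc (proj_Icc 0 1 (\<rho> / \<epsilon>)) 1 (3 / (\<epsilon> / \<rho> + 1)) = min 1 (3 / (\<epsilon> / \<rho> + 1))"
proof (cases "3 / (\<epsilon> / \<rho> + 1) < 1")
  case True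
  with assms have "2 * \<rho> < \<epsilon>"
    by (simp add: field_simps)
  then have "\<rho> / \<epsilon> \<le> 3 / (\<epsilon> / \<rho> + 1)"
    using assms by (simp add: field_simps)
  moreover have "0 \<le> \<rho> / \<epsilon>" "\<rho> / \<epsilon> \<le> 1"
    using assms \<open>2 * \<rho> < \<epsilon>\<close> by auto
  ultimately show ?thesis
    using True by (simp add: proj_Icc_def)
next
  case False
  then show ?thesis
    by (auto simp: proj_Icc_def min_def max_def)
qed

text \<open>In terms of the effective size \<open>2 / \<alpha> - 1 \<ge> 1\<close>, the rate
  \<open>\<beta>\<close> realizes the peak \<open>a / 3\<close> raised to at least 1, so each size
  is compared with it from one side of the peak. Rate 0 loses by nonnegativity.\<close>

lemma smoothing_limit_le:
  fixes \<epsilon> \<rho> :: real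
  assumes "\<epsilon> > 0" "\<rho> > 0" "\<alpha> \<in> {0..1}"
  defines "\<beta> \<equiv> min 1 (3 / (\<epsilon> / \<rho> + 1))"
  shows "smoothing_limit \<epsilon> \<rho> \<alpha> \<le> smoothing_limit \<epsilon> \<rho> \<beta>"
proof -
  define a where "a = 2 * \<epsilon> / \<rho> - 1"
  have pos: "0 < 3 / (\<epsilon> / \<rho> + 1)"
    using assms by (simp add: add_pos_pos)
  then have \<beta>: "0 < \<beta>" "\<beta> \<le> 1" by (auto simp: \<beta>_def)
  \<comment> \<open>Taking reciprocals turns the minimum into a maximum, and
    \<open>2 * (\<epsilon> / \<rho> + 1) / 3 - 1 = a / 3\<close>.\<close>
  have size: "2 / \<beta> - 1 = max 1 (a / 3)"
  proof -
    have "1 / min 1 (3 / r) = max 1 (r / 3)" if "r > 0" for r :: real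
      using that by (auto simp: min_def max_def field_simps)
    then have "1 / \<beta> = max 1 ((\<epsilon> / \<rho> + 1) / 3)"
      using assms(1,2) by (simp add: \<beta>_def add_pos_pos)
    then have "2 / \<beta> - 1 = 2 * max 1 ((\<epsilon> / \<rho> + 1) / 3) - 1" by simp
    also have "\<dots> = max 1 (a / 3)"
      unfolding a_def max_def by (simp split: if_split flip: times_divide_eq_right) argo
    finally show ?thesis .
  qed
  show ?thesis
  proof (cases "\<alpha> = 0")
    case True
    then show ?thesis
      using \<beta> size profile_nonneg[of "max 1 (a / 3)"] by (simp add: smoothing_limit_def)
  next
    case False
    with assms have "1 \<le> 2 / \<alpha> - 1" by (auto simp: field_simps)
    have "profile a (2 / \<alpha> - 1) \<le> profile a (max 1 (a / 3))"
    proof (cases "2 / \<alpha> - 1 \<le> a / 3")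
      case True
      with \<open>1 \<le> 2 / \<alpha> - 1\<close> show ?thesis
        by (intro profile_mono) auto
    next
      case False
      with \<open>1 \<le> 2 / \<alpha> - 1\<close> show ?thesis
        by (intro profile_antimono) auto
    qed
    then show ?thesis
      using False \<beta> by (simp add: smoothing_limit_def size mult_left_mono flip: a_def)
  qed
qed

lemma optimal_decay_rate:
  assumes "\<epsilon> > 0" "\<rho> > 0"
  shows "is_arg_max (\<lambda>\<alpha>. lim (\<lambda>T. objective \<epsilon> \<rho> T (smoothing_weights T \<alpha>))) (\<lambda>\<alpha>. \<alpha> \<in> {0..1})
           (proj_Icc (proj_Icc 0 1 (\<rho> / \<epsilon>)) 1 (3 / (\<epsilon> / \<rho> + 1)))"
proof -
  have lim: "lim (\<lambda>T. objective \<epsilon> \<rho> T (smoothing_weights T \<alpha>)) = smoothing_limit \<epsilon> \<rho> \<alpha>"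
    if "\<alpha> \<in> {0..1}" for \<alpha>
    using LIMSEQ_objective_smoothing[OF assms(2) that] by (rule limI)
  have dom: "min 1 (3 / (\<epsilon> / \<rho> + 1)) \<in> {0..1}"
    using assms by (simp add: add_pos_pos)
  show ?thesis
    unfolding is_arg_max_linorder proj_decay_rate[OF assms]
    using dom smoothing_limit_le[OF assms] lim by metis
qed

text \<open>The convergence conjunct ensures that \<open>lim\<close> denotes a genuine limit at
  every admissible rate.\<close>

theorem proposition3:
  fixes \<epsilon> \<rho> :: real
  assumes "\<epsilon> > 0" and "\<rho> > 0"
  shows
    "(\<forall>T::nat. T \<ge> 1 \<longrightarrow>
        (\<forall>s\<in>{1..T}. window_weights T s \<in> weights T) \<and>
        (is_arg_max (\<lambda>s. objective \<epsilon> \<rho> T (window_weights T s)) (\<lambda>s. s \<in> {1..T})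
           (nat (proj_Icc 1 (int T) \<lfloor>1 / 3 * (2 * \<epsilon> / \<rho> - 1)\<rfloor>)) \<or>
         is_arg_max (\<lambda>s. objective \<epsilon> \<rho> T (window_weights T s)) (\<lambda>s. s \<in> {1..T})
           (nat (proj_Icc 1 (int T) \<lceil>1 / 3 * (2 * \<epsilon> / \<rho> - 1)\<rceil>))))
     \<and>
     (\<forall>T::nat. T \<ge> 1 \<longrightarrow> (\<forall>\<alpha>\<in>{0..1}. smoothing_weights T \<alpha> \<in> weights T)) \<and>
     (\<forall>\<alpha>\<in>{0..1}. convergent (\<lambda>T. objective \<epsilon> \<rho> T (smoothing_weights T \<alpha>))) \<and>
     is_arg_max (\<lambda>\<alpha>. lim (\<lambda>T. objective \<epsilon> \<rho> T (smoothing_weights T \<alpha>))) (\<lambda>\<alpha>. \<alpha> \<in> {0..1})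
       (proj_Icc (proj_Icc 0 1 (\<rho> / \<epsilon>)) 1 (3 / (\<epsilon> / \<rho> + 1)))"
  using window_weights_in_weights optimal_window_size[OF assms(2)] smoothing_weights_in_weights
    LIMSEQ_objective_smoothing[OF assms(2), THEN convergentI] optimal_decay_rate[OF assms]
  by blast

end
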